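(* Let $\phi\in\mathcal{P}_{(v_0,w_1,\ldots,w_n)}$ be a parametrization in reduced form with semigroup $\Gamma=\langle v_0,v_1,v_2,\ldots,v_g\rangle$, and let $t^{v_1}+\sum_{j>v_1,\ j\notin\Gamma\cup(\Gamma+v_1-v_0)}a_{1j}t^j$ be its second component (recall $w_1=v_1$). Suppose that some $a_{1j}$ is nonzero, so that $$\lambda=\min\{j\notin\Gamma\cup(\Gamma+v_1-v_0) : a_{1j}\neq 0\}$$ exists. If $\lambda<v_2$, then $\lambda$ is invariant under the action of the admissible pairs of diffeomorphisms. That is: whenever $(\rho,\sigma)$ is an admissible pair for $\phi$ such that $\psi=\sigma\circ\phi\circ\rho^{-1}\in\mathcal{P}_{(v_0,w_1,\ldots,w_n)}$ is again in reduced form, with second component $t^{v_1}+\sum_{j>v_1,\ j\notin\Gamma\cup(\Gamma+v_1-v_0)}b_{1j}t^j$, then some $b_{1j}$ is nonzero and $\min\{j\notin\Gamma\cup(\Gamma+v_1-v_0) : b_{1j}\ne0\}=\lambda$.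
   Context: Let $n\ge1$. A parametrization is an analytic map-germ $\phi=(p_0,\ldots,p_n):(\mathbb{C},0)\to(\mathbb{C}^{n+1},0)$; all parametrizations are assumed primitive (not of the form $\psi(\tau(t))$ with $\mathrm{ord}_t\,\tau\ge 2$) and non-degenerate (not equal, after analytic coordinate changes in source and target, to a map-germ with an identically zero component). The value semigroup is $\Gamma=\Gamma(\phi)=\{\mathrm{ord}_t(g(\phi(t))) : g\in\mathbb{C}\{X,Y_1,\ldots,Y_n\},\ g(\phi(t))\neq 0\}$, a numerical semigroup, with minimal generating set $v_0<v_1<\cdots<v_g$; here $g\ge 2$ so that $v_2$ is defined. For $1\le i\le n$, $\Gamma_i=\{\mathrm{ord}_t(h(p_0,\ldots,p_{i-1})) : h\in\mathbb{C}\{X,Y_1,\ldots,Y_{i-1}\},\ h(p_0,\ldots,p_{i-1})\ne 0\}$. $\mathcal{P}_{(v_0,w_1,\ldots,w_n)}$ is the set of parametrizations $\phi(t)=(t^{v_0},y_1(t),\ldots,y_n(t))$ such that $y_i(t)=t^{w_i}+(\text{terms of order}>w_i)$ and $w_i=\min(\Gamma\setminus\Gamma_i)$ for $1\le i\le n$, with $v_0=w_0<w_1<\cdots<w_n$, $v_0=\min(\Gamma\setminus\{0\})$. In particular $w_1=v_1$. Such a $\phi$ is in reduced form if $y_1(t)=t^{w_1}+\sum_{j>w_1,\ j\notin\Gamma\cup(\Gamma+v_1-v_0)}a_{1j}t^j$ and $y_i(t)=t^{w_i}+\sum_{j>w_i,\ j\notin\Gamma}a_{ij}t^j$ for $2\le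 i\le n$, where $\Gamma+v_1-v_0=\{\gamma+v_1-v_0:\gamma\in\Gamma\}$. A pair $(\rho,\sigma)\in\mathrm{Diff}(\mathbb{C},0)\times\mathrm{Diff}(\mathbb{C}^{n+1},0)$ is admissible for $\phi$ if $\rho(t)=t\left(\epsilon^{v_0}+\frac{h_0(\phi(t))}{t^{v_0}}\right)^{1/v_0}$ (branch of the root with $\rho'(0)=\epsilon$), $\sigma=(\sigma_0,\ldots,\sigma_n)$ with $\sigma_0=\epsilon^{v_0}X+h_0$, $\sigma_k=\epsilon^{w_k}Y_k+h_k$ for $1\le k\le n$, where $\epsilon\in\mathbb{C}^*$ and $h_k\in\langle Y_{k+1},\ldots,Y_n\rangle+\mathcal{M}_{n+1}^2$ satisfies $\mathrm{ord}_t(h_k(\phi(t)))>w_k$ for $0\le k\le n$. Here $\mathcal{M}_{n+1}=\langle X,Y_1,\ldots,Y_n\rangle\subset\mathbb{C}\{X,Y_1,\ldots,Y_n\}$. *)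

theory Defs
  imports "HOL-Analysis.Analysis" "HOL-Library.Poly_Mapping"
    "HOL-Computational_Algebra.Formal_Power_Series"
begin

section \<open>Convergent power series in several variables\<close>

text \<open>
  A multi-index is a finitely supported function on variable numbers, and a power series is its
  family of coefficients. Variable 0 is $X$ and variable $k \ge 1$ is $Y_k$, so
  the ring of convergent power series in $X, Y_1, \ldots, Y_{m-1}$ is \<open>conv_series m\<close>.
\<close>

type_synonym mindex = "nat \<Rightarrow>\<^sub>0 nat"
type_synonym mseries = "mindex \<Rightarrow> complex"

definition mdeg :: "mindex \<Rightarrow> nat" where
  "mdeg \<alpha> = (\<Sum>i\<in>Poly_Mapping.keys \<alpha>. Poly_Mapping.lookup \<alpha> i)"

text \<open>Convergence near the origin, as absolute convergence on some closed polydisc.\<close>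

definition conv_series :: "nat \<Rightarrow> mseries set" where
  "conv_series m = {f. (\<forall>\<alpha>. f \<alpha> \<noteq> 0 \<longrightarrow> Poly_Mapping.keys \<alpha> \<subseteq> {..<m}) \<and>
     (\<exists>r>0. (\<lambda>\<alpha>. norm (f \<alpha>) * r ^ mdeg \<alpha>) summable_on UNIV)}"

definition ms_var :: "nat \<Rightarrow> mseries" where
  "ms_var i = (\<lambda>\<alpha>. if \<alpha> = Poly_Mapping.single i 1 then 1 else 0)"

definition ms_mult :: "mseries \<Rightarrow> mseries \<Rightarrow> mseries" where
  "ms_mult f g = (\<lambda>\<alpha>. \<Sum>(\<beta>, \<gamma>) | \<beta> + \<gamma> = \<alpha>. f \<beta> * g \<gamma>)"

definition ms_ideal :: "nat \<Rightarrow> mseries set \<Rightarrow> mseries set" where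
  "ms_ideal m S = {(\<lambda>\<alpha>. \<Sum>s\<in>F. ms_mult (c s) s \<alpha>) | F c.
     finite F \<and> F \<subseteq> S \<and> (\<forall>s\<in>F. c s \<in> conv_series m)}"

definition ms_ideal_sum :: "mseries set \<Rightarrow> mseries set \<Rightarrow> mseries set" where
  "ms_ideal_sum I J = {(\<lambda>\<alpha>. a \<alpha> + b \<alpha>) | a b. a \<in> I \<and> b \<in> J}"

definition ms_ideal_mult :: "nat \<Rightarrow> mseries set \<Rightarrow> mseries set \<Rightarrow> mseries set" where
  "ms_ideal_mult m I J = ms_ideal m {ms_mult a b | a b. a \<in> I \<and> b \<in> J}"

definition max_ideal :: "nat \<Rightarrow> mseries set" where
  "max_ideal m = ms_ideal m (ms_var ` {..<m})"

definition ms_eval :: "mseries \<Rightarrow> (nat \<Rightarrow> complex) \<Rightarrow> complex" where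
  "ms_eval f z = (\<Sum>\<^sub>\<infinity>\<alpha>. f \<alpha> * (\<Prod>i\<in>Poly_Mapping.keys \<alpha>. z i ^ Poly_Mapping.lookup \<alpha> i))"

text \<open>
  \<open>ms_subst m f \<phi>\<close> is the series $f(\phi_0(t), \ldots, \phi_{m-1}(t))$. It is only meaningful if all
  $\phi_i$ vanish at 0: then multi-indices of degree greater than $j$ do not contribute to the
  coefficient of $t^j$, and the sum below runs over a finite set.
\<close>

definition ms_subst :: "nat \<Rightarrow> mseries \<Rightarrow> (nat \<Rightarrow> complex fps) \<Rightarrow> complex fps" where
  "ms_subst m f \<phi> = Abs_fps (\<lambda>j. \<Sum>\<alpha> | Poly_Mapping.keys \<alpha> \<subseteq> {..<m} \<and> mdeg \<alpha> \<le> j.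
     f \<alpha> * fps_nth (\<Prod>i<m. \<phi> i ^ Poly_Mapping.lookup \<alpha> i) j)"

text \<open>The index sets of the two finite sums above are indeed finite.\<close>

lemma finite_mindex_le_deg: "finite {\<alpha>::mindex. Poly_Mapping.keys \<alpha> \<subseteq> {..<m} \<and> mdeg \<alpha> \<le> j}"
proof (rule finite_imageD)
  show "inj_on Poly_Mapping.lookup {\<alpha>::mindex. Poly_Mapping.keys \<alpha> \<subseteq> {..<m} \<and> mdeg \<alpha> \<le> j}"
    by (simp add: inj_on_def)
  have "Poly_Mapping.lookup \<alpha> x \<le> j \<and> (x \<notin> {..<m} \<longrightarrow> Poly_Mapping.lookup \<alpha> x = 0)"
    if k: "Poly_Mapping.keys \<alpha> \<subseteq> {..<m}" and d: "mdeg \<alpha> \<le> j" for \<alpha> :: mindex and x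
  proof (cases "x \<in> Poly_Mapping.keys \<alpha>")
    case True
    then have "Poly_Mapping.lookup \<alpha> x \<le> mdeg \<alpha>"
      unfolding mdeg_def by (intro member_le_sum) auto
    with d True k show ?thesis by auto
  qed (simp add: Poly_Mapping.in_keys_iff)
  then have "Poly_Mapping.lookup ` {\<alpha>::mindex. Poly_Mapping.keys \<alpha> \<subseteq> {..<m} \<and> mdeg \<alpha> \<le> j}
      \<subseteq> {h. \<forall>x. (x \<in> {..<m} \<longrightarrow> h x \<in> {..j}) \<and> (x \<notin> {..<m} \<longrightarrow> h x = 0)}"
    by (intro subsetI, elim imageE CollectE conjE) simp
  moreover have "finite {h. \<forall>x::nat. (x \<in> {..<m} \<longrightarrow> h x \<in> {..j}) \<and> (x \<notin> {..<m} \<longrightarrow> h x = (0::nat))}"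
    by (rule finite_set_of_finite_funs) auto
  ultimately show "finite (Poly_Mapping.lookup ` {\<alpha>::mindex. Poly_Mapping.keys \<alpha> \<subseteq> {..<m} \<and> mdeg \<alpha> \<le> j})"
    by (rule finite_subset)
qed

lemma finite_mindex_splits: "finite {(\<beta>, \<gamma>). \<beta> + \<gamma> = (\<alpha>::mindex)}"
proof -
  obtain m where m: "Poly_Mapping.keys \<alpha> \<subseteq> {..<m}"
    using finite_nat_iff_bounded Poly_Mapping.finite_keys by blast
  have *: "Poly_Mapping.keys \<beta> \<subseteq> {..<m} \<and> mdeg \<beta> \<le> mdeg \<alpha>" if "\<beta> + \<gamma> = \<alpha>" for \<beta> \<gamma>
  proof -
    have sub: "Poly_Mapping.keys \<beta> \<subseteq> Poly_Mapping.keys \<alpha>"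
      using that by (auto simp: Poly_Mapping.in_keys_iff Poly_Mapping.lookup_add)
    have "mdeg \<beta> \<le> (\<Sum>i\<in>Poly_Mapping.keys \<beta>. Poly_Mapping.lookup \<alpha> i)"
      unfolding mdeg_def using that by (intro sum_mono) (auto simp: Poly_Mapping.lookup_add)
    also have "\<dots> \<le> mdeg \<alpha>"
      unfolding mdeg_def using sub by (intro sum_mono2) auto
    finally show ?thesis using sub m by auto
  qed
  let ?A = "{\<beta>::mindex. Poly_Mapping.keys \<beta> \<subseteq> {..<m} \<and> mdeg \<beta> \<le> mdeg \<alpha>}"
  have "{(\<beta>, \<gamma>). \<beta> + \<gamma> = \<alpha>} \<subseteq> ?A \<times> ?A"
  proof (rule subsetI, unfold mem_Collect_eq split_paired_all case_prod_conv)
    fix \<beta> \<gamma> :: mindex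
    assume \<beta>\<gamma>: "\<beta> + \<gamma> = \<alpha>"
    have "\<gamma> + \<beta> = \<alpha>" by (subst add.commute) (rule \<beta>\<gamma>)
    with \<beta>\<gamma> show "(\<beta>, \<gamma>) \<in> ?A \<times> ?A"
      by (intro SigmaI CollectI *)
  qed
  moreover have "finite (?A \<times> ?A)"
    by (intro finite_cartesian_product finite_mindex_le_deg)
  ultimately show ?thesis by (rule finite_subset)
qed

section \<open>Analytic map-germs and diffeomorphisms\<close>

text \<open>
  A map-germ from $(\mathbb{C},0)$ to $(\mathbb{C}^{n+1},0)$ is a function on component numbers, of
  which only the components $0, \ldots, n$ matter. The same convention is used for map-germs from
  $(\mathbb{C}^{n+1},0)$ to itself.
\<close>

definition curve_germ :: "nat \<Rightarrow> (nat \<Rightarrow> complex fps) \<Rightarrow> bool" where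
  "curve_germ n \<phi> \<longleftrightarrow> (\<forall>i\<le>n. fps_conv_radius (\<phi> i) > 0 \<and> fps_nth (\<phi> i) 0 = 0)"

definition Diff1 :: "complex fps set" where
  "Diff1 = {\<rho>. fps_conv_radius \<rho> > 0 \<and> fps_nth \<rho> 0 = 0 \<and>
     (\<exists>\<tau>. fps_conv_radius \<tau> > 0 \<and> fps_nth \<tau> 0 = 0 \<and> \<rho> oo \<tau> = fps_X \<and> \<tau> oo \<rho> = fps_X)}"

definition space_germ :: "nat \<Rightarrow> (nat \<Rightarrow> mseries) \<Rightarrow> bool" where
  "space_germ n \<sigma> \<longleftrightarrow> (\<forall>i\<le>n. \<sigma> i \<in> conv_series (Suc n) \<and> \<sigma> i 0 = 0)"

definition Diff :: "nat \<Rightarrow> (nat \<Rightarrow> mseries) set" where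
  "Diff n = {\<sigma>. space_germ n \<sigma> \<and> (\<exists>\<tau>. space_germ n \<tau> \<and>
     (\<exists>\<delta>>0. \<forall>z. (\<forall>i\<le>n. norm (z i) < \<delta>) \<longrightarrow>
        (\<forall>i\<le>n. ms_eval (\<tau> i) (\<lambda>k. ms_eval (\<sigma> k) z) = z i \<and>
                ms_eval (\<sigma> i) (\<lambda>k. ms_eval (\<tau> k) z) = z i)))}"

text \<open>The germ $\sigma \circ \phi \circ \rho^{-1}$.\<close>

definition germ_action ::
  "nat \<Rightarrow> complex fps \<Rightarrow> (nat \<Rightarrow> mseries) \<Rightarrow> (nat \<Rightarrow> complex fps) \<Rightarrow> nat \<Rightarrow> complex fps" where
  "germ_action n \<rho> \<sigma> \<phi> = (\<lambda>k. ms_subst (Suc n) (\<sigma> k) \<phi> oo fps_inv \<rho>)"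

text \<open>In the next definition the zero series $\tau$ is regarded as having infinite order.\<close>

definition primitive_germ :: "nat \<Rightarrow> (nat \<Rightarrow> complex fps) \<Rightarrow> bool" where
  "primitive_germ n \<phi> \<longleftrightarrow>
     \<not> (\<exists>\<psi> \<tau>. curve_germ n \<psi> \<and> fps_conv_radius \<tau> > 0 \<and> (\<tau> = 0 \<or> subdegree \<tau> \<ge> 2) \<and>
          (\<forall>i\<le>n. \<phi> i = \<psi> i oo \<tau>))"

definition nondegenerate_germ :: "nat \<Rightarrow> (nat \<Rightarrow> complex fps) \<Rightarrow> bool" where
  "nondegenerate_germ n \<phi> \<longleftrightarrow>
     \<not> (\<exists>\<rho>\<in>Diff1. \<exists>\<sigma>\<in>Diff n. \<exists>k\<le>n. germ_action n \<rho> \<sigma> \<phi> k = 0)"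

definition parametrization :: "nat \<Rightarrow> (nat \<Rightarrow> complex fps) \<Rightarrow> bool" where
  "parametrization n \<phi> \<longleftrightarrow> curve_germ n \<phi> \<and> primitive_germ n \<phi> \<and> nondegenerate_germ n \<phi>"

section \<open>Value semigroups\<close>

text \<open>
  The orders of the nonzero series $h(\phi_0, \ldots, \phi_{m-1})$. For a germ $\phi$ with components
  $0, \ldots, n$, the semigroup $\Gamma(\phi)$ is \<open>value_set (Suc n) \<phi>\<close> and $\Gamma_i$ is \<open>value_set i \<phi>\<close>.
\<close>

definition value_set :: "nat \<Rightarrow> (nat \<Rightarrow> complex fps) \<Rightarrow> nat set" where
  "value_set m \<phi> = {subdegree (ms_subst m h \<phi>) | h. h \<in> conv_series m \<and> ms_subst m h \<phi> \<noteq> 0}"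

inductive_set semigroup_gen :: "nat set \<Rightarrow> nat set" for A where
  zero: "0 \<in> semigroup_gen A"
| add: "a \<in> A \<Longrightarrow> b \<in> semigroup_gen A \<Longrightarrow> a + b \<in> semigroup_gen A"

definition minimal_generators :: "nat \<Rightarrow> (nat \<Rightarrow> nat) \<Rightarrow> nat set \<Rightarrow> bool" where
  "minimal_generators g v \<Gamma> \<longleftrightarrow> strict_mono_on {..g} v \<and> semigroup_gen (v ` {..g}) = \<Gamma> \<and>
     (\<forall>B. B \<subset> v ` {..g} \<longrightarrow> semigroup_gen B \<noteq> \<Gamma>)"

definition is_minimum :: "nat \<Rightarrow> nat set \<Rightarrow> bool" where
  "is_minimum a A \<longleftrightarrow> a \<in> A \<and> (\<forall>b\<in>A. a \<le> b)"

section \<open>Parametrizations of fixed type, reduced forms and admissible pairs\<close>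

text \<open>Here \<open>w 0\<close> is the multiplicity $v_0$.\<close>

definition params :: "nat \<Rightarrow> (nat \<Rightarrow> nat) \<Rightarrow> (nat \<Rightarrow> complex fps) set" where
  "params n w = {\<phi>. parametrization n \<phi> \<and>
     strict_mono_on {..n} w \<and> is_minimum (w 0) (value_set (Suc n) \<phi> - {0}) \<and>
     \<phi> 0 = fps_X ^ w 0 \<and>
     (\<forall>i\<in>{1..n}. is_minimum (w i) (value_set (Suc n) \<phi> - value_set i \<phi>) \<and>
        fps_nth (\<phi> i) (w i) = 1 \<and> (\<forall>j<w i. fps_nth (\<phi> i) j = 0))}"

text \<open>
  The set $\Gamma \cup (\Gamma + v_1 - v_0)$ of excluded exponents. It is used with $v_0 < v_1$, so the
  subtraction is not truncated.
\<close>

definition excluded_exps :: "nat set \<Rightarrow> nat \<Rightarrow> nat \<Rightarrow> nat set" where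
  "excluded_exps \<Gamma> v0 v1 = \<Gamma> \<union> (\<lambda>\<gamma>. \<gamma> + v1 - v0) ` \<Gamma>"

text \<open>For \<open>\<phi> \<in> params n w\<close> the generators $v_0$ and $v_1$ are \<open>w 0\<close> and \<open>w 1\<close>.\<close>

definition reduced_form :: "nat \<Rightarrow> (nat \<Rightarrow> nat) \<Rightarrow> (nat \<Rightarrow> complex fps) \<Rightarrow> bool" where
  "reduced_form n w \<phi> \<longleftrightarrow>
     (\<forall>j>w 1. j \<in> excluded_exps (value_set (Suc n) \<phi>) (w 0) (w 1) \<longrightarrow> fps_nth (\<phi> 1) j = 0) \<and>
     (\<forall>i\<in>{2..n}. \<forall>j>w i. j \<in> value_set (Suc n) \<phi> \<longrightarrow> fps_nth (\<phi> i) j = 0)"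

text \<open>
  The exponents $j$ with $j > v_1$, $j \notin \Gamma \cup (\Gamma + v_1 - v_0)$ and nonzero coefficient
  of $t^j$ in the second component.
\<close>

definition second_exps ::
  "nat set \<Rightarrow> nat \<Rightarrow> nat \<Rightarrow> (nat \<Rightarrow> complex fps) \<Rightarrow> nat set" where
  "second_exps \<Gamma> v0 v1 \<phi> = {j. j > v1 \<and> j \<notin> excluded_exps \<Gamma> v0 v1 \<and> fps_nth (\<phi> 1) j \<noteq> 0}"

text \<open>
  In the formula for $\rho$, \<open>fps_shift\<close> divides by $t^{v_0}$ (exactly, as the order of
  $h_0(\phi(t))$ exceeds $v_0$), and the first argument of \<open>fps_radical\<close> selects the $v_0$-th root
  with constant term $\epsilon$, so that $\rho'(0) = \epsilon$.
\<close>

definition admissible ::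
  "nat \<Rightarrow> (nat \<Rightarrow> nat) \<Rightarrow> (nat \<Rightarrow> complex fps) \<Rightarrow> complex fps \<Rightarrow> (nat \<Rightarrow> mseries) \<Rightarrow> bool" where
  "admissible n w \<phi> \<rho> \<sigma> \<longleftrightarrow> \<rho> \<in> Diff1 \<and> \<sigma> \<in> Diff n \<and>
     (\<exists>\<epsilon> h. \<epsilon> \<noteq> 0 \<and>
        \<rho> = fps_X * fps_radical (\<lambda>_ _. \<epsilon>) (w 0)
              (fps_const (\<epsilon> ^ w 0) + fps_shift (w 0) (ms_subst (Suc n) (h 0) \<phi>)) \<and>
        (\<forall>k\<le>n. \<sigma> k = (\<lambda>\<alpha>. \<epsilon> ^ w k * ms_var k \<alpha> + h k \<alpha>) \<and>
           h k \<in> ms_ideal_sum (ms_ideal (Suc n) (ms_var ` {k+1..n}))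
                   (ms_ideal_mult (Suc n) (max_ideal (Suc n)) (max_ideal (Suc n))) \<and>
           (ms_subst (Suc n) (h k) \<phi> = 0 \<or> w k < subdegree (ms_subst (Suc n) (h k) \<phi>))))"

end

(* Let S be the semigroup generated by v_0 and v_1, and let mu > v_1 be the least exponent
   with nonzero coefficient a_mu or b_mu in the second component of phi or psi, so mu <= lambda.
   Since lambda < v_2, the series h_0(phi) and h_1(phi) have exponents in S below lambda, and
   so has h_1(phi) at lambda. Compare coefficients in psi_1(rho) = epsilon^v_1 phi_1 + h_1(phi):
   below mu this shows that rho^v_1, like rho^v_0 = epsilon^v_0 t^v_0 + h_0(phi), has exponents
   in S. Writing rho = t R, the first exponent k of R outside S would satisfy k + v_0, k + v_1 in S,
   which forces k + v_0 + v_1 >= lcm(v_0, v_1); past this bound S contains all multiples of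
   gcd(v_0, v_1), whereas mu is not in S (if the gcd does not divide mu, the same argument with
   its multiples in place of S is enough). Hence rho^v_1 has no term of order mu, and the
   comparison at mu gives b_mu epsilon^mu = epsilon^v_1 a_mu. So both are nonzero and mu = lambda. *)

theory Submission
  imports Defs
begin

section \<open>Semigroups with two generators\<close>

definition gen2 :: "nat \<Rightarrow> nat \<Rightarrow> nat set" where
  "gen2 a b = {i * a + l * b | i l. True}"

lemma gen2I: "i * a + l * b \<in> gen2 a b"
  unfolding gen2_def by blast

lemma gen2_add: "x \<in> gen2 a b \<Longrightarrow> y \<in> gen2 a b \<Longrightarrow> x + y \<in> gen2 a b"
proof -
  assume "x \<in> gen2 a b" "y \<in> gen2 a b"
  then obtain i l j k where "x = i * a + l * b" "y = j * a + k * b"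
    unfolding gen2_def by blast
  then have "x + y = (i + j) * a + (l + k) * b" by (simp add: algebra_simps)
  then show ?thesis using gen2I by metis
qed

lemma gen2_0: "0 \<in> gen2 a b"
  using gen2I[of 0 a 0 b] by simp

lemma gen2_dvd: "x \<in> gen2 a b \<Longrightarrow> gcd a b dvd x"
  unfolding gen2_def by auto

text \<open>Bezout represents \<open>x\<close> with integer coefficients. Trading copies of
  \<open>lcm a b\<close> between the two summands brings the coefficient of \<open>a\<close> into
  the range from 0 to \<open>b' - 1\<close>, where \<open>b'\<close> is \<open>b\<close> divided by
  the gcd. The lower bound on \<open>x\<close> then forces the coefficient of \<open>b\<close> to
  exceed -1.\<close>

lemma gen2_frobenius:
  fixes a b x :: nat
  assumes a: "a > 0" and b: "b > 0" and d: "gcd a b dvd x" and x: "lcm a b < x + a + b"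
  shows "x \<in> gen2 a b"
proof -
  define d where "d = int (gcd a b)"
  have dpos: "d > 0" using a by (simp add: d_def)
  obtain b' where b': "int b = d * b'" unfolding d_def
    by (metis dvdE gcd_dvd2 int_dvd_int_iff)
  obtain a' where a': "int a = d * a'" unfolding d_def
    by (metis dvdE gcd_dvd1 int_dvd_int_iff)
  obtain q where q: "int x = d * q" unfolding d_def
    by (metis assms(3) dvdE int_dvd_int_iff)
  obtain u v where uv: "u * int a + v * int b = d"
    using bezout_int[of "int a" "int b"] unfolding d_def by auto
  have b'pos: "b' > 0" using b' b dpos by (metis of_nat_0_less_iff zero_less_mult_pos)
  have "int (lcm a b) * d = int a * int b"
    unfolding d_def by (metis of_nat_mult prod_gcd_lcm_nat mult.commute)
  then have "int (lcm a b) * d = (b' * int a) * d" using b' by (simp add: algebra_simps)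
  then have lcm: "int (lcm a b) = b' * int a" using dpos by simp
  \<comment> \<open>The quotient \<open>r\<close> passes to the coefficient of \<open>b\<close>,
    because \<open>b' * a\<close> and \<open>a' * b\<close> agree.\<close>
  define s where "s = (q * u) mod b'"
  define r where "r = (q * u) div b'"
  define t where "t = q * v + r * a'"
  have s: "0 \<le> s" "s \<le> b' - 1" using b'pos by (auto simp: s_def)
  have qu: "q * u = r * b' + s" by (simp add: r_def s_def)
  have "int x = q * u * int a + q * v * int b"
    using q uv by (metis (no_types, opaque_lifting) distrib_left mult.assoc mult.commute)
  also have "\<dots> = s * int a + r * b' * int a + q * v * int b" by (simp add: qu algebra_simps)
  also have "\<dots> = s * int a + t * int b" by (simp add: t_def a' b' algebra_simps)
  finally have xs: "int x = s * int a + t * int b" .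
  have "s * int a \<le> (b' - 1) * int a" using s by (intro mult_right_mono) auto
  then have "- int b < t * int b" using x xs lcm by (simp add: algebra_simps)
  then have "0 < (t + 1) * int b" by (simp add: algebra_simps)
  then have "t \<ge> 0" using b by (simp add: zero_less_mult_iff)
  then have "int x = int (nat s * a + nat t * b)" using xs s by simp
  then have "x = nat s * a + nat t * b" by (simp only: of_nat_eq_iff)
  then show ?thesis using gen2I by metis
qed

section \<open>Semigroups with a minimal generating set\<close>

lemma semigroup_gen_mono: "x \<in> semigroup_gen A \<Longrightarrow> A \<subseteq> B \<Longrightarrow> x \<in> semigroup_gen B"
  by (induction rule: semigroup_gen.induct) (auto intro: semigroup_gen.intros)

lemma semigroup_gen_base: "a \<in> A \<Longrightarrow> a \<in> semigroup_gen A"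
  using semigroup_gen.add[OF _ semigroup_gen.zero] by fastforce

lemma semigroup_gen_plus:
  "x \<in> semigroup_gen A \<Longrightarrow> y \<in> semigroup_gen A \<Longrightarrow> x + y \<in> semigroup_gen A"
  by (induction rule: semigroup_gen.induct) (auto simp: add.assoc intro: semigroup_gen.intros)

lemma semigroup_gen_mult: "a \<in> A \<Longrightarrow> k * a \<in> semigroup_gen A"
  by (induction k) (auto intro: semigroup_gen.intros)

lemma semigroup_gen_idem: "x \<in> semigroup_gen (semigroup_gen A) \<Longrightarrow> x \<in> semigroup_gen A"
  by (induction rule: semigroup_gen.induct) (auto intro: semigroup_gen_plus semigroup_gen.zero)

text \<open>No summand exceeds the sum, so \<open>v 0\<close> is the only generator small enough to
  occur.\<close>

lemma minimal_generators_less_v1: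
  assumes mg: "minimal_generators g v \<Gamma>" and x: "x \<in> \<Gamma>" "x < v 1" and g: "g \<ge> 1"
  shows "v 0 dvd x"
proof -
  have mono: "strict_mono_on {..g} v" and gen: "semigroup_gen (v ` {..g}) = \<Gamma>"
    using mg by (auto simp: minimal_generators_def)
  have "x \<in> semigroup_gen (v ` {..g})" using x gen by simp
  then show ?thesis using x(2)
  proof (induction rule: semigroup_gen.induct)
    case (add c b)
    then obtain i where i: "i \<le> g" "c = v i" by auto
    have "i = 0"
    proof (rule ccontr)
      assume "i \<noteq> 0"
      then have "v 1 \<le> v i" using mono i g
        by (intro monotone_onD[OF strict_mono_on_imp_mono_on[OF mono]]) auto
      then show False using add.prems i by simp
    qed
    then show ?case using add i by simp
  qed simp
qed

lemma minimal_generators_less_v2: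
  assumes mg: "minimal_generators g v \<Gamma>" and x: "x \<in> \<Gamma>" "x < v 2" and g: "g \<ge> 2"
  shows "x \<in> gen2 (v 0) (v 1)"
proof -
  have mono: "strict_mono_on {..g} v" and gen: "semigroup_gen (v ` {..g}) = \<Gamma>"
    using mg by (auto simp: minimal_generators_def)
  have "x \<in> semigroup_gen (v ` {..g})" using x gen by simp
  then show ?thesis using x(2)
  proof (induction rule: semigroup_gen.induct)
    case (add c b)
    then obtain i where i: "i \<le> g" "c = v i" by auto
    have "i < 2"
    proof (rule ccontr)
      assume "\<not> i < 2"
      then have "v 2 \<le> v i" using mono i g
        by (intro monotone_onD[OF strict_mono_on_imp_mono_on[OF mono]]) auto
      then show False using add.prems i by simp
    qed
    then have "i = 0 \<or> i = 1" by auto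
    then have "c \<in> gen2 (v 0) (v 1)"
      using i gen2I[of 1 "v 0" 0 "v 1"] gen2I[of 0 "v 0" 1 "v 1"] by auto
    then show ?case using add by (simp add: gen2_add)
  qed (rule gen2_0)
qed

text \<open>A multiple of \<open>v 0\<close> would be a redundant generator, against
  minimality.\<close>

lemma minimal_generators_v1_not_dvd:
  assumes mg: "minimal_generators g v \<Gamma>" and g: "g \<ge> 1"
  shows "\<not> v 0 dvd v 1"
proof
  assume "v 0 dvd v 1"
  then obtain k where k: "v 1 = k * v 0" by (metis dvd_def mult.commute)
  have mono: "strict_mono_on {..g} v" and gen: "semigroup_gen (v ` {..g}) = \<Gamma>"
    and min: "\<And>B. B \<subset> v ` {..g} \<Longrightarrow> semigroup_gen B \<noteq> \<Gamma>"
    using mg by (auto simp: minimal_generators_def)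
  let ?B = "v ` {..g} - {v 1}"
  have v01: "v 0 < v 1" using mono g by (auto intro: strict_mono_onD)
  have "v ` {..g} \<subseteq> semigroup_gen ?B"
  proof
    fix x assume x: "x \<in> v ` {..g}"
    show "x \<in> semigroup_gen ?B"
    proof (cases "x = v 1")
      case True
      have "v 0 \<in> ?B" using v01 by auto
      then show ?thesis using True k semigroup_gen_mult by simp
    qed (use x in \<open>auto intro: semigroup_gen_base\<close>)
  qed
  then have "\<Gamma> \<subseteq> semigroup_gen ?B"
    unfolding gen[symmetric] using semigroup_gen_idem[OF semigroup_gen_mono[of _ "v ` {..g}"]]
    by (intro subsetI)
  moreover have "semigroup_gen ?B \<subseteq> \<Gamma>"
    unfolding gen[symmetric] using semigroup_gen_mono[of _ ?B "v ` {..g}"] by blast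
  moreover have "?B \<subset> v ` {..g}" using g by auto
  ultimately show False using min[of ?B] by blast
qed

section \<open>Supports of powers of power series\<close>

text \<open>Exponents of a product are sums of exponents of the factors, none larger than the total.
  Hence information on \<open>R\<close> below \<open>m\<close> suffices below
  \<open>m\<close>.\<close>

lemma fps_nth_power_support:
  fixes R :: "'a::comm_ring_1 fps"
  assumes M0: "0 \<in> M" and Madd: "\<And>x y. x \<in> M \<Longrightarrow> y \<in> M \<Longrightarrow> x + y \<in> M"
    and R: "\<And>j. j < m \<Longrightarrow> fps_nth R j \<noteq> 0 \<Longrightarrow> j \<in> M"
  shows "j < m \<Longrightarrow> fps_nth (R ^ k) j \<noteq> 0 \<Longrightarrow> j \<in> M"
proof (induction k arbitrary: j)
  case 0
  then show ?case using M0 by (cases "j = 0") auto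
next
  case (Suc k)
  have "(\<Sum>i=0..j. fps_nth R i * fps_nth (R ^ k) (j - i)) \<noteq> 0"
    using Suc.prems by (simp add: fps_mult_nth)
  then obtain i where i: "i \<le> j" "fps_nth R i * fps_nth (R ^ k) (j - i) \<noteq> 0"
    by (rule sum.not_neutral_contains_not_neutral) auto
  then have "fps_nth R i \<noteq> 0" "fps_nth (R ^ k) (j - i) \<noteq> 0" by (metis mult_zero_left, metis mult_zero_right)
  then have "i \<in> M" "j - i \<in> M" using R[of i] Suc.IH[of "j - i"] Suc.prems i by auto
  then show ?case using Madd[of i "j - i"] i by simp
qed

text \<open>Exponents from \<open>M\<close> cannot add up to \<open>m\<close>, and all exponents of
  \<open>R\<close> below \<open>m\<close> lie in \<open>M\<close>. So in a product of
  \<open>k\<close> terms of total order \<open>m\<close>, one factor has exponent \<open>m\<close>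
  and the others are constant terms, with \<open>k\<close> choices for that factor. For
  \<open>k = 0\<close> the factor \<open>of_nat k\<close> makes the truncated \<open>k - 1\<close>
  harmless.\<close>

lemma fps_nth_power_first_gap:
  fixes R :: "'a::comm_ring_1 fps"
  assumes M0: "0 \<in> M" and Madd: "\<And>x y. x \<in> M \<Longrightarrow> y \<in> M \<Longrightarrow> x + y \<in> M"
    and R: "\<And>j. j < m \<Longrightarrow> fps_nth R j \<noteq> 0 \<Longrightarrow> j \<in> M" and m: "m \<notin> M"
  shows "fps_nth (R ^ k) m = of_nat k * fps_nth R 0 ^ (k - 1) * fps_nth R m"
proof (induction k)
  case 0
  then show ?case using M0 m by (cases m) auto
next
  case (Suc k)
  have m0: "m > 0" using M0 m by (cases m) auto
  have z: "fps_nth R i * fps_nth (R ^ k) (m - i) = 0" if i: "0 < i" "i < m" for i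
  proof (rule ccontr)
    assume "\<not> ?thesis"
    then have "fps_nth R i \<noteq> 0" "fps_nth (R ^ k) (m - i) \<noteq> 0"
      by (metis mult_zero_left, metis mult_zero_right)
    then have "i \<in> M" "m - i \<in> M"
      using R[of i] fps_nth_power_support[where M = M and m = m and j = "m - i" and k = k, OF M0 Madd R] i by auto
    then show False using Madd[of i "m - i"] i m by simp
  qed
  have "fps_nth (R ^ Suc k) m = (\<Sum>i=0..m. fps_nth R i * fps_nth (R ^ k) (m - i))"
    by (simp add: fps_mult_nth)
  also have "\<dots> = (\<Sum>i\<in>{0, m}. fps_nth R i * fps_nth (R ^ k) (m - i))"
    using z by (intro sum.mono_neutral_right) auto
  also have "\<dots> = fps_nth R 0 * fps_nth (R ^ k) m + fps_nth R m * fps_nth R 0 ^ k"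
    using m0 by (simp add: fps_nth_power_0)
  also have "\<dots> = of_nat (Suc k) * fps_nth R 0 ^ (Suc k - 1) * fps_nth R m"
    unfolding Suc by (cases k) (simp_all add: algebra_simps)
  finally show ?case .
qed

text \<open>To be applied to \<open>R\<close> with \<open>\<rho> = fps_X * R\<close>, so that
  \<open>A\<close> and \<open>B\<close> describe the supports of \<open>\<rho> ^ a\<close> and
  \<open>\<rho> ^ b\<close>. \<open>A\<close> reaches the order \<open>\<mu> - b\<close> itself;
  \<open>B\<close> stops before it, since the coefficient there is the one to be shown zero.\<close>

lemma gap_coefficient_vanishes:
  fixes R :: "'a::{idom, ring_char_0} fps"
  assumes a: "0 < a" and ab: "a < b" and bm: "b < \<mu>" and R0: "fps_nth R 0 \<noteq> 0"
    and \<mu>1: "\<mu> \<notin> gen2 a b" and \<mu>2: "\<mu> - b + a \<notin> gen2 a b"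
    and A: "\<And>j. j \<le> \<mu> - b \<Longrightarrow> fps_nth (R ^ a) j \<noteq> 0 \<Longrightarrow> j + a \<in> gen2 a b"
    and B: "\<And>j. j < \<mu> - b \<Longrightarrow> fps_nth (R ^ b) j \<noteq> 0 \<Longrightarrow> j + b \<in> gen2 a b"
  shows "fps_nth (R ^ b) (\<mu> - b) = 0"
proof -
  define m where "m = \<mu> - b"
  have m\<mu>: "m + b = \<mu>" using bm by (simp add: m_def)
  show ?thesis
  proof (cases "gcd a b dvd \<mu>")
    case False
    define M where "M = {x. gcd a b dvd x}"
    have M: "0 \<in> M" "\<And>x y. x \<in> M \<Longrightarrow> y \<in> M \<Longrightarrow> x + y \<in> M" by (auto simp: M_def)
    have Rd: "j \<le> m \<Longrightarrow> fps_nth R j \<noteq> 0 \<Longrightarrow> j \<in> M" for j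
    proof (induction j rule: less_induct)
      case (less j)
      show ?case
      proof (rule ccontr)
        assume j: "j \<notin> M"
        \<comment> \<open>At the first exponent of \<open>R\<close> outside \<open>M\<close> the
          power has a nonzero multiple of the same coefficient, which makes \<open>A\<close>
          applicable.\<close>
        have "fps_nth (R ^ a) j = of_nat a * fps_nth R 0 ^ (a - 1) * fps_nth R j"
          using less by (intro fps_nth_power_first_gap[OF M _ j]) auto
        then have "fps_nth (R ^ a) j \<noteq> 0" using a R0 less.prems by simp
        then have "gcd a b dvd j + a" using A[of j] less.prems gen2_dvd by (auto simp: m_def)
        then show False using j by (simp add: M_def dvd_add_left_iff)
      qed
    qed
    have mM: "m \<notin> M" using False m\<mu> by (metis M_def dvd_add gcd_dvd2 mem_Collect_eq)
    have "fps_nth (R ^ b) m = of_nat b * fps_nth R 0 ^ (b - 1) * fps_nth R m"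
      using Rd by (intro fps_nth_power_first_gap[OF M _ mM]) auto
    then show ?thesis using Rd[of m] mM by (auto simp: m_def)
  next
    case True
    note M = gen2_0[of a b] gen2_add[of _ a b]
    have mM: "m \<notin> gen2 a b" using \<mu>1 m\<mu> gen2_add[of m a b b] gen2I[of 0 a 1 b] by auto
    have *: "j \<in> gen2 a b" if jm: "j < m" and nz: "fps_nth R j \<noteq> 0" for j
      using jm nz
    proof (induction j rule: less_induct)
      case (less k)
      show ?case
      proof (rule ccontr)
        assume k: "k \<notin> gen2 a b"
        have pow: "fps_nth (R ^ c) k = of_nat c * fps_nth R 0 ^ (c - 1) * fps_nth R k" for c
          using less by (intro fps_nth_power_first_gap[OF M _ k]) auto
        have "k + a \<in> gen2 a b" "k + b \<in> gen2 a b"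
          using A[of k] B[of k] pow[of a] pow[of b] a ab R0 less.prems by (auto simp: m_def)
        then obtain i l i' l' where il: "k + a = i * a + l * b" "k + b = i' * a + l' * b"
          unfolding gen2_def by blast
        \<comment> \<open>Otherwise removing one \<open>b\<close> from \<open>k + b\<close> would
          represent \<open>k\<close>. Together with \<open>i = 0\<close>, shown in the same way,
          this makes \<open>k + a + b\<close> a common multiple of \<open>a\<close> and
          \<open>b\<close>.\<close>
        have "l' = 0"
        proof (cases l')
          case (Suc l'')
          then have "k = i' * a + l'' * b" using il by simp
          then show ?thesis using k gen2I by metis
        qed
        have "i = 0"
        proof (cases i)
          case (Suc i'')
          then have "k = i'' * a + l * b" using il by simp
          then show ?thesis using k gen2I by metis
        qed
        have "k + a + b = (i' + 1) * a" "k + a + b = (l + 1) * b" using il \<open>l' = 0\<close> \<open>i = 0\<close> by auto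
        then have "lcm a b dvd k + a + b" by (metis dvd_triv_right lcm_least)
        then have "lcm a b \<le> k + a + b" using a by (intro dvd_imp_le) auto
        \<comment> \<open>Since \<open>k < m\<close>, the lcm is less than \<open>\<mu> + a\<close>,
          within the range of \<open>gen2_frobenius\<close>.\<close>
        then have "\<mu> \<in> gen2 a b"
          using a ab True less.prems m\<mu> by (intro gen2_frobenius) auto
        then show False using \<mu>1 by simp
      qed
    qed
    have pow: "fps_nth (R ^ c) m = of_nat c * fps_nth R 0 ^ (c - 1) * fps_nth R m" for c
      using * by (intro fps_nth_power_first_gap[OF M _ mM]) auto
    \<comment> \<open>A nonzero coefficient would put \<open>m + a = \<mu> - b + a\<close> into the
      semigroup by \<open>A\<close>. The coefficients of \<open>R ^ a\<close> and
      \<open>R ^ b\<close> at \<open>m\<close> are both multiples of that of \<open>R\<close>, so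
      the vanishing passes from one power to the other.\<close>
    have "fps_nth (R ^ a) m = 0" using A[of m] \<mu>2 by (auto simp: m_def)
    then have "fps_nth R m = 0" using pow[of a] a R0 by simp
    then show ?thesis using pow[of b] by (simp add: m_def)
  qed
qed

lemma fps_nth_power_sparse:
  fixes U :: "'a::comm_ring_1 fps"
  assumes "fps_nth U 0 = 1" and "\<And>j. 0 < j \<Longrightarrow> j < m \<Longrightarrow> fps_nth U j = 0"
  shows "0 < j \<Longrightarrow> j < m \<Longrightarrow> fps_nth (U ^ k) j = 0"
  using fps_nth_power_support[where M = "{0}" and R = U and m = m and j = j and k = k] assms by fastforce

section \<open>Substitution of a curve into a series\<close>

definition ms_monom :: "mindex \<Rightarrow> mseries" where
  "ms_monom \<alpha> = (\<lambda>\<beta>. if \<beta> = \<alpha> then 1 else 0)"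

lemma ms_var_eq: "ms_var i = ms_monom (Poly_Mapping.single i 1)"
  by (simp add: ms_var_def ms_monom_def)

lemma ms_monom_conv:
  assumes "Poly_Mapping.keys \<alpha> \<subseteq> {..<m}"
  shows "ms_monom \<alpha> \<in> conv_series m"
proof -
  have "(\<lambda>\<beta>. norm (ms_monom \<alpha> \<beta>) * 1 ^ mdeg \<beta>) summable_on {\<alpha>}" by simp
  then have "(\<lambda>\<beta>. norm (ms_monom \<alpha> \<beta>) * 1 ^ mdeg \<beta>) summable_on UNIV"
    by (rule summable_on_cong_neutral[THEN iffD1, rotated -1]) (auto simp: ms_monom_def)
  then show ?thesis
    using assms unfolding conv_series_def
    by (intro CollectI conjI exI[of _ 1]) (auto simp: ms_monom_def split: if_splits)
qed

text \<open>Each \<open>\<phi> i\<close> is divisible by \<open>fps_X\<close>, so the product is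
  divisible by \<open>fps_X\<close> to the power \<open>mdeg \<alpha>\<close>. Hence the degree
  bound in the sum of \<open>ms_subst\<close> discards only zero terms.\<close>

lemma prod_power_nth_low:
  fixes \<phi> :: "nat \<Rightarrow> complex fps"
  assumes k: "Poly_Mapping.keys \<alpha> \<subseteq> {..<m}" and \<phi>: "\<And>i. i < m \<Longrightarrow> fps_nth (\<phi> i) 0 = 0"
    and j: "j < mdeg \<alpha>"
  shows "fps_nth (\<Prod>i<m. \<phi> i ^ Poly_Mapping.lookup \<alpha> i) j = 0"
proof -
  have X: "fps_X dvd \<phi> i" if "i < m" for i
    using \<phi>[OF that] by (intro dvdI[of _ _ "fps_shift 1 (\<phi> i)"] fps_ext) simp
  have "mdeg \<alpha> = (\<Sum>i<m. Poly_Mapping.lookup \<alpha> i)"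
    unfolding mdeg_def using k by (intro sum.mono_neutral_left) (auto simp: in_keys_iff)
  then have "fps_X ^ mdeg \<alpha> = (\<Prod>i<m. (fps_X :: complex fps) ^ Poly_Mapping.lookup \<alpha> i)"
    by (simp add: power_sum)
  also have "\<dots> dvd (\<Prod>i<m. \<phi> i ^ Poly_Mapping.lookup \<alpha> i)"
    using X by (intro prod_dvd_prod dvd_power_same) auto
  finally obtain c where "(\<Prod>i<m. \<phi> i ^ Poly_Mapping.lookup \<alpha> i) = fps_X ^ mdeg \<alpha> * c" ..
  then show ?thesis using j by (simp add: fps_X_power_mult_nth)
qed

lemma ms_subst_monom:
  assumes k: "Poly_Mapping.keys \<alpha> \<subseteq> {..<m}" and \<phi>: "\<And>i. i < m \<Longrightarrow> fps_nth (\<phi> i) 0 = 0"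
  shows "ms_subst m (ms_monom \<alpha>) \<phi> = (\<Prod>i<m. \<phi> i ^ Poly_Mapping.lookup \<alpha> i)"
proof (rule fps_ext)
  fix j
  let ?A = "{\<beta>. Poly_Mapping.keys \<beta> \<subseteq> {..<m} \<and> mdeg \<beta> \<le> j}"
  let ?p = "\<lambda>\<beta>. fps_nth (\<Prod>i<m. \<phi> i ^ Poly_Mapping.lookup \<beta> i) j"
  have "fps_nth (ms_subst m (ms_monom \<alpha>) \<phi>) j = (\<Sum>\<beta>\<in>?A. if \<beta> = \<alpha> then ?p \<alpha> else 0)"
    unfolding ms_subst_def ms_monom_def by (auto intro!: sum.cong)
  also have "\<dots> = (if \<alpha> \<in> ?A then ?p \<alpha> else 0)"
    using finite_mindex_le_deg[of m j] by (simp only: sum.delta)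
  also have "\<dots> = ?p \<alpha>" using prod_power_nth_low[where j = j, OF k \<phi>] k by auto
  finally show "fps_nth (ms_subst m (ms_monom \<alpha>) \<phi>) j = ?p \<alpha>" .
qed

lemma ms_subst_linear:
  "ms_subst m (\<lambda>\<alpha>. c * f \<alpha> + h \<alpha>) \<phi> = fps_const c * ms_subst m f \<phi> + ms_subst m h \<phi>"
  unfolding ms_subst_def
  by (intro fps_ext) (simp add: sum.distrib sum_distrib_left algebra_simps)

lemma ms_subst_nth_nonzeroE:
  assumes "fps_nth (ms_subst m h \<phi>) j \<noteq> 0"
  obtains \<alpha> where "Poly_Mapping.keys \<alpha> \<subseteq> {..<m}" "h \<alpha> \<noteq> 0"
    "fps_nth (\<Prod>i<m. \<phi> i ^ Poly_Mapping.lookup \<alpha> i) j \<noteq> 0"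
proof -
  obtain \<alpha> where "\<alpha> \<in> {\<alpha>. Poly_Mapping.keys \<alpha> \<subseteq> {..<m} \<and> mdeg \<alpha> \<le> j}"
    "h \<alpha> * fps_nth (\<Prod>i<m. \<phi> i ^ Poly_Mapping.lookup \<alpha> i) j \<noteq> 0"
    using assms unfolding ms_subst_def fps_nth_Abs_fps by (rule sum.not_neutral_contains_not_neutral)
  then show ?thesis using that by auto
qed

lemma prod_lessThan_Suc_split2:
  fixes f :: "nat \<Rightarrow> 'a::comm_monoid_mult"
  assumes "n \<ge> 1"
  shows "(\<Prod>i<Suc n. f i) = f 0 * f 1 * (\<Prod>i\<in>{2..n}. f i)"
proof -
  have "{..<Suc n} = insert 0 (insert 1 {2..n})" using assms by auto
  then show ?thesis by (simp add: mult.assoc)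
qed

lemma value_set_monom:
  assumes "Poly_Mapping.keys \<alpha> \<subseteq> {..<m}" and "\<And>i. i < m \<Longrightarrow> fps_nth (\<phi> i) 0 = 0"
    and "(\<Prod>i<m. \<phi> i ^ Poly_Mapping.lookup \<alpha> i) \<noteq> 0"
  shows "subdegree (\<Prod>i<m. \<phi> i ^ Poly_Mapping.lookup \<alpha> i) \<in> value_set m \<phi>"
  unfolding value_set_def using ms_subst_monom[of \<alpha> m \<phi>] ms_monom_conv[of \<alpha> m] assms
  by (intro CollectI exI[of _ "ms_monom \<alpha>"]) auto

text \<open>Each element is the order of a monomial in the first two variables.\<close>

lemma gen2_subset_value_set:
  assumes m: "m \<ge> 2" and \<phi>: "\<And>i. i < m \<Longrightarrow> fps_nth (\<phi> i) 0 = 0"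
    and nz: "\<phi> 0 \<noteq> 0" "\<phi> 1 \<noteq> 0"
  shows "gen2 (subdegree (\<phi> 0)) (subdegree (\<phi> 1)) \<subseteq> value_set m \<phi>"
proof
  fix x assume "x \<in> gen2 (subdegree (\<phi> 0)) (subdegree (\<phi> 1))"
  then obtain i l where x: "x = i * subdegree (\<phi> 0) + l * subdegree (\<phi> 1)"
    unfolding gen2_def by blast
  define \<alpha> where "\<alpha> = Poly_Mapping.single (0::nat) i + Poly_Mapping.single 1 l"
  have lk: "Poly_Mapping.lookup \<alpha> k = (if k = 0 then i else if k = 1 then l else 0)" for k
    by (simp add: \<alpha>_def lookup_add lookup_single when_def)
  have keys: "Poly_Mapping.keys \<alpha> \<subseteq> {..<m}"
    using m by (auto simp: in_keys_iff lk split: if_splits)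
  have p: "(\<Prod>i<m. \<phi> i ^ Poly_Mapping.lookup \<alpha> i) = \<phi> 0 ^ i * \<phi> 1 ^ l"
    using prod_lessThan_Suc_split2[of "m - 1" "\<lambda>i. \<phi> i ^ Poly_Mapping.lookup \<alpha> i"] m by (simp add: lk)
  then show "x \<in> value_set m \<phi>"
    using value_set_monom[where \<phi> = \<phi>, OF keys \<phi>] nz x by (simp add: subdegree_mult)
qed

lemma mult_in_value_set_1:
  assumes "fps_nth (\<phi> 0) 0 = 0" and "\<phi> 0 \<noteq> 0"
  shows "i * subdegree (\<phi> 0) \<in> value_set 1 \<phi>"
  using value_set_monom[of "Poly_Mapping.single 0 i" 1 \<phi>] assms
  by (cases "i = 0") (auto simp: lookup_single when_def)

lemma value_set_1_dvd:
  assumes "\<phi> 0 = fps_X ^ a" and "x \<in> value_set 1 \<phi>"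
  shows "a dvd x"
proof -
  obtain h where h: "x = subdegree (ms_subst 1 h \<phi>)" "ms_subst 1 h \<phi> \<noteq> 0"
    using assms by (auto simp: value_set_def)
  then have "fps_nth (ms_subst 1 h \<phi>) x \<noteq> 0" by simp
  then obtain \<alpha> where "fps_nth (\<Prod>i<1. \<phi> i ^ Poly_Mapping.lookup \<alpha> i) x \<noteq> 0"
    by (rule ms_subst_nth_nonzeroE)
  then have "fps_nth (fps_X ^ (a * Poly_Mapping.lookup \<alpha> 0) :: complex fps) x \<noteq> 0"
    using assms(1) by (simp add: power_mult)
  then show ?thesis by (auto split: if_splits)
qed

text \<open>Up to order \<open>L\<close>, the only monomial whose value along the curve has an exponent outside the
  semigroup is $Y_1$ itself.\<close>

lemma prod_power_nth_nonzeroD: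
  fixes \<phi> :: "nat \<Rightarrow> complex fps"
  assumes n: "n \<ge> 1" and ab: "0 < a" "a < b" "b < L"
    and \<phi>0: "\<phi> 0 = fps_X ^ a"
    and \<phi>1: "fps_nth (\<phi> 1) b = 1" "\<And>j. j < L \<Longrightarrow> j \<noteq> b \<Longrightarrow> fps_nth (\<phi> 1) j = 0"
    and \<phi>k: "\<And>k j. k \<in> {2..n} \<Longrightarrow> j \<le> L \<Longrightarrow> fps_nth (\<phi> k) j = 0"
    and keys: "Poly_Mapping.keys \<alpha> \<subseteq> {..<Suc n}" and j: "j \<le> L"
    and nz: "fps_nth (\<Prod>i<Suc n. \<phi> i ^ Poly_Mapping.lookup \<alpha> i) j \<noteq> 0"
  shows "Poly_Mapping.keys \<alpha> \<subseteq> {0, 1} \<and> j = Poly_Mapping.lookup \<alpha> 0 * a + Poly_Mapping.lookup \<alpha> 1 * b \<or>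
         j = L \<and> \<alpha> = Poly_Mapping.single 1 1"
proof -
  let ?\<alpha> = "Poly_Mapping.lookup \<alpha>"
  \<comment> \<open>A factor \<open>\<phi> k\<close> with \<open>k \<ge> 2\<close> has order above
    \<open>L\<close> and would make the whole product vanish through order \<open>L\<close>.\<close>
  have \<alpha>k: "?\<alpha> k = 0" if k: "k \<in> {2..n}" for k
  proof (rule ccontr)
    assume "?\<alpha> k \<noteq> 0"
    have "fps_X ^ Suc L dvd \<phi> k"
      using \<phi>k[OF k] by (intro dvdI[of _ _ "fps_shift (Suc L) (\<phi> k)"] fps_ext)
        (auto simp: fps_X_power_mult_nth simp del: power_Suc)
    also have "\<phi> k dvd \<phi> k ^ ?\<alpha> k" using \<open>?\<alpha> k \<noteq> 0\<close> by (intro dvd_power) auto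
    also have "\<dots> dvd (\<Prod>i<Suc n. \<phi> i ^ ?\<alpha> i)" using k by (intro dvd_prodI) auto
    finally obtain c where "(\<Prod>i<Suc n. \<phi> i ^ ?\<alpha> i) = fps_X ^ Suc L * c" ..
    then show False using nz j by (simp add: fps_X_power_mult_nth del: power_Suc)
  qed
  have keys01: "Poly_Mapping.keys \<alpha> \<subseteq> {0, 1}"
  proof
    fix k assume "k \<in> Poly_Mapping.keys \<alpha>"
    then have "k \<le> n" "?\<alpha> k \<noteq> 0" using keys by (force, simp add: in_keys_iff)
    then show "k \<in> {0, 1}" using \<alpha>k[of k] by (cases "k < 2") auto
  qed
  \<comment> \<open>\<open>U\<close> is 1 plus terms of order at least \<open>L - b\<close>, so the
    product is \<open>fps_X ^ e\<close> times a power of such a series.\<close>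
  define U where "U = fps_shift b (\<phi> 1)"
  have \<phi>1U: "\<phi> 1 = fps_X ^ b * U"
    using \<phi>1 ab by (intro fps_ext) (auto simp: U_def fps_X_power_mult_nth)
  have U: "fps_nth U 0 = 1" "\<And>j. 0 < j \<Longrightarrow> j < L - b \<Longrightarrow> fps_nth U j = 0"
    using \<phi>1 by (auto simp: U_def)
  define e where "e = ?\<alpha> 0 * a + ?\<alpha> 1 * b"
  have "(\<Prod>i<Suc n. \<phi> i ^ ?\<alpha> i) = fps_X ^ e * U ^ ?\<alpha> 1"
    using \<alpha>k \<phi>0 \<phi>1U unfolding prod_lessThan_Suc_split2[OF n] e_def
    by (simp add: power_add power_mult power_mult_distrib mult.commute[of a] mult.commute[of b] mult.assoc
        flip: power_mult)
  then have e: "e \<le> j" "fps_nth (U ^ ?\<alpha> 1) (j - e) \<noteq> 0"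
    using nz by (auto simp: fps_X_power_mult_nth split: if_splits)
  show ?thesis
  proof (cases "j = e")
    case False
    \<comment> \<open>An exponent other than \<open>e\<close> must use a higher term of
      \<open>U\<close>. Since \<open>j \<le> L\<close>, this leaves only \<open>e \<le> b\<close>,
      which forces the monomial to be \<open>Y_1\<close>.\<close>
    then have "L - b \<le> j - e" using fps_nth_power_sparse[where j = "j - e" and k = "?\<alpha> 1", OF U] e by force
    then have eb: "e \<le> b" using j ab e by linarith
    have "?\<alpha> 1 \<noteq> 0" using e False by (cases "?\<alpha> 1") auto
    moreover have "?\<alpha> 1 * b \<le> 1 * b" using eb unfolding e_def by linarith
    then have "?\<alpha> 1 \<le> 1" using ab by (metis mult_le_cancel2 gr_zeroI less_nat_zero_code)
    ultimately have 1: "?\<alpha> 1 = 1" by simp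
    then have 0: "?\<alpha> 0 = 0" using eb ab by (simp add: e_def)
    have "\<alpha> = Poly_Mapping.single 1 1"
    proof (rule poly_mapping_eqI)
      fix k show "?\<alpha> k = Poly_Mapping.lookup (Poly_Mapping.single 1 1) k"
        using keys01 0 1 by (cases "k \<in> {0,1}") (auto simp: lookup_single when_def in_keys_iff)
    qed
    moreover have "j = L" using \<open>L - b \<le> j - e\<close> 0 1 j ab e by (simp add: e_def)
    ultimately show ?thesis by simp
  qed (use keys01 e_def in simp)
qed

text \<open>Some monomial of \<open>h\<close> contributes to the coefficient. The second alternative
  records that the exceptional monomial \<open>Y_1\<close> occurs in \<open>h\<close>.\<close>

lemma ms_subst_support:
  fixes \<phi> :: "nat \<Rightarrow> complex fps"
  assumes n: "n \<ge> 1" and ab: "0 < a" "a < b" "b < L"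
    and \<phi>0: "\<phi> 0 = fps_X ^ a"
    and \<phi>1: "fps_nth (\<phi> 1) b = 1" "\<And>j. j < L \<Longrightarrow> j \<noteq> b \<Longrightarrow> fps_nth (\<phi> 1) j = 0"
    and \<phi>k: "\<And>k j. k \<in> {2..n} \<Longrightarrow> j \<le> L \<Longrightarrow> fps_nth (\<phi> k) j = 0"
    and j: "j \<le> L" and nz: "fps_nth (ms_subst (Suc n) h \<phi>) j \<noteq> 0"
  shows "j \<in> gen2 a b \<or> j = L \<and> h (Poly_Mapping.single 1 1) \<noteq> 0"
  using nz
proof (rule ms_subst_nth_nonzeroE)
  fix \<alpha> :: mindex
  assume "Poly_Mapping.keys \<alpha> \<subseteq> {..<Suc n}" and h: "h \<alpha> \<noteq> 0"
    and "fps_nth (\<Prod>i<Suc n. \<phi> i ^ Poly_Mapping.lookup \<alpha> i) j \<noteq> 0"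
  from prod_power_nth_nonzeroD[where \<phi> = \<phi>, OF n ab \<phi>0 \<phi>1 \<phi>k this(1) j this(3)]
  show ?thesis using h gen2I by metis
qed

text \<open>As \<open>a\<close> does not divide \<open>b\<close>, no power of \<open>X\<close> has
  order \<open>b\<close>, and \<open>Y_1\<close> is the only monomial with a term there. This turns
  the order condition on \<open>h_1\<close> into the absence of a linear \<open>Y_1\<close>
  term.\<close>

lemma ms_subst_nth_order_second:
  fixes \<phi> :: "nat \<Rightarrow> complex fps"
  assumes n: "n \<ge> 1" and ab: "0 < a" "a < b" "b < L" and dvd: "\<not> a dvd b"
    and \<phi>0: "\<phi> 0 = fps_X ^ a"
    and \<phi>1: "fps_nth (\<phi> 1) b = 1" "\<And>j. j < L \<Longrightarrow> j \<noteq> b \<Longrightarrow> fps_nth (\<phi> 1) j = 0"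
    and \<phi>k: "\<And>k j. k \<in> {2..n} \<Longrightarrow> j \<le> L \<Longrightarrow> fps_nth (\<phi> k) j = 0"
  shows "fps_nth (ms_subst (Suc n) h \<phi>) b = h (Poly_Mapping.single 1 1)"
proof -
  let ?s = "Poly_Mapping.single (1::nat) (1::nat)"
  let ?A = "{\<alpha>. Poly_Mapping.keys \<alpha> \<subseteq> {..<Suc n} \<and> mdeg \<alpha> \<le> b}"
  let ?p = "\<lambda>\<alpha>. fps_nth (\<Prod>i<Suc n. \<phi> i ^ Poly_Mapping.lookup \<alpha> i) b"
  have "?p \<alpha> = 0" if \<alpha>: "\<alpha> \<in> ?A - {?s}" for \<alpha>
  proof (rule ccontr)
    assume "?p \<alpha> \<noteq> 0"
    then have keys: "Poly_Mapping.keys \<alpha> \<subseteq> {0, 1}"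
      and b: "b = Poly_Mapping.lookup \<alpha> 0 * a + Poly_Mapping.lookup \<alpha> 1 * b"
      using prod_power_nth_nonzeroD[where \<phi> = \<phi>, OF n ab \<phi>0 \<phi>1 \<phi>k, of \<alpha> b] \<alpha> ab by auto
    have "Poly_Mapping.lookup \<alpha> 1 \<noteq> 0"
    proof
      assume "Poly_Mapping.lookup \<alpha> 1 = 0"
      then have "b = Poly_Mapping.lookup \<alpha> 0 * a" using b by simp
      then show False using dvd by (metis dvd_triv_right)
    qed
    moreover have "Poly_Mapping.lookup \<alpha> 1 * b \<le> 1 * b" using b by linarith
    then have "Poly_Mapping.lookup \<alpha> 1 \<le> 1"
      using ab by (metis mult_le_cancel2 gr_zeroI less_nat_zero_code)
    ultimately have 1: "Poly_Mapping.lookup \<alpha> 1 = 1" by simp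
    then have 0: "Poly_Mapping.lookup \<alpha> 0 = 0" using b ab by auto
    have "\<alpha> = ?s"
    proof (rule poly_mapping_eqI)
      fix k show "Poly_Mapping.lookup \<alpha> k = Poly_Mapping.lookup ?s k"
        using keys 0 1 by (cases "k \<in> {0,1}") (auto simp: lookup_single when_def in_keys_iff)
    qed
    then show False using \<alpha> by simp
  qed
  then have "fps_nth (ms_subst (Suc n) h \<phi>) b = (\<Sum>\<alpha>\<in>{?s}. h \<alpha> * ?p \<alpha>)"
    unfolding ms_subst_def fps_nth_Abs_fps using n ab
    by (intro sum.mono_neutral_right finite_mindex_le_deg) (auto simp: mdeg_def)
  also have "\<dots> = h ?s"
    using prod_lessThan_Suc_split2[OF n, of "\<lambda>i. \<phi> i ^ Poly_Mapping.lookup ?s i"] \<phi>1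
    by (simp add: lookup_single when_def)
  finally show ?thesis .
qed

section \<open>Exponents of parametrizations\<close>

lemma paramsD:
  assumes "\<phi> \<in> params n w" "n \<ge> 1"
  shows "0 < w 0" "w 0 < w 1" "\<phi> 0 = fps_X ^ w 0"
    and "\<And>i. i < Suc n \<Longrightarrow> fps_nth (\<phi> i) 0 = 0"
    and "\<And>i. i \<in> {1..n} \<Longrightarrow> fps_nth (\<phi> i) (w i) = 1"
    and "\<And>i j. i \<in> {1..n} \<Longrightarrow> j < w i \<Longrightarrow> fps_nth (\<phi> i) j = 0"
    and "\<And>i. i \<in> {1..n} \<Longrightarrow> is_minimum (w i) (value_set (Suc n) \<phi> - value_set i \<phi>)"
  using assms unfolding params_def parametrization_def curve_germ_def is_minimum_def
  by (auto intro: strict_mono_onD)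

lemma params_gen2_subset:
  assumes \<phi>: "\<phi> \<in> params n w" and n: "n \<ge> 1" and m: "m \<in> {2..Suc n}"
  shows "gen2 (w 0) (w 1) \<subseteq> value_set m \<phi>"
proof -
  note p = paramsD[OF \<phi> n]
  have s: "subdegree (\<phi> 0) = w 0" "subdegree (\<phi> 1) = w 1"
    using p(3) p(5,6)[of 1] n by (auto intro: subdegreeI)
  have nz: "\<phi> 0 \<noteq> 0" "\<phi> 1 \<noteq> 0" using p(3) p(5)[of 1] n by auto
  show ?thesis using gen2_subset_value_set[of m \<phi>] m p(4) nz s by auto
qed

text \<open>\<open>\<Gamma>_1\<close> consists of the multiples of \<open>v 0\<close>, so both
  numbers are the least element of the semigroup that is not such a multiple.\<close>

lemma params_v1:
  assumes \<phi>: "\<phi> \<in> params n w" and n: "n \<ge> 1" and g: "g \<ge> 1"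
    and mg: "minimal_generators g v (value_set (Suc n) \<phi>)" and w0: "w 0 = v 0"
  shows "w 1 = v 1"
proof (rule antisym)
  note p = paramsD[OF \<phi> n]
  have min: "is_minimum (w 1) (value_set (Suc n) \<phi> - value_set 1 \<phi>)" using p(7)[of 1] n by simp
  have "v 1 \<in> value_set (Suc n) \<phi>"
    using mg g by (auto simp: minimal_generators_def intro: semigroup_gen_base)
  moreover have "v 1 \<notin> value_set 1 \<phi>"
    using value_set_1_dvd[where \<phi> = \<phi>, OF p(3)] minimal_generators_v1_not_dvd[OF mg g] w0 by auto
  ultimately show "w 1 \<le> v 1" using min by (auto simp: is_minimum_def)
  have "\<not> w 0 dvd w 1"
  proof
    assume "w 0 dvd w 1"
    then obtain i where "w 1 = i * subdegree (\<phi> 0)" using p(3) by (auto simp: dvd_def mult.commute)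
    then have "w 1 \<in> value_set 1 \<phi>" using mult_in_value_set_1[of \<phi> i] p(3) p(4)[of 0] by simp
    then show False using min by (simp add: is_minimum_def)
  qed
  then show "v 1 \<le> w 1"
    using minimal_generators_less_v1[OF mg, of "w 1"] min g w0 by (force simp: is_minimum_def)
qed

text \<open>\<open>\<Gamma>_k\<close> already contains everything generated by \<open>v 0\<close>
  and \<open>v 1\<close>, hence every element of the semigroup below \<open>v 2\<close>. So the
  later components have no terms below order \<open>v 2\<close>.\<close>

lemma params_v2_le:
  assumes \<phi>: "\<phi> \<in> params n w" and n: "n \<ge> 1" and g: "g \<ge> 2"
    and mg: "minimal_generators g v (value_set (Suc n) \<phi>)" and w0: "w 0 = v 0"
    and k: "k \<in> {2..n}"
  shows "v 2 \<le> w k"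
proof (rule ccontr)
  assume "\<not> v 2 \<le> w k"
  moreover have min: "w k \<in> value_set (Suc n) \<phi> - value_set k \<phi>"
    using paramsD(7)[OF \<phi> n, of k] k by (auto simp: is_minimum_def)
  ultimately have "w k \<in> gen2 (v 0) (v 1)" using minimal_generators_less_v2[OF mg _ _ g] by auto
  then show False
    using params_gen2_subset[OF \<phi> n, of k] k min w0 params_v1[OF \<phi> n _ mg w0] g by auto
qed

text \<open>Reducedness of \<open>\<psi>\<close> refers to the value semigroup of
  \<open>\<psi>\<close>. Below \<open>v 2\<close>, exclusion by \<open>\<Gamma>\<close> involves
  only elements generated by \<open>v 0\<close> and \<open>v 1\<close>, which both semigroups
  contain, so no equality of the two semigroups has to be established.\<close>

lemma excluded_exps_below_v2:
  assumes mg: "minimal_generators g v \<Gamma>" and g: "g \<ge> 2" and v: "v 0 < v 1"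
    and G': "gen2 (v 0) (v 1) \<subseteq> \<Gamma>'"
    and j: "j < v 2" and ex: "j \<in> excluded_exps \<Gamma> (v 0) (v 1)"
  shows "j \<in> excluded_exps \<Gamma>' (v 0) (v 1)"
proof -
  have *: "x \<in> \<Gamma>'" if "x \<in> \<Gamma>" "x \<le> j" for x
    using minimal_generators_less_v2[OF mg that(1) _ g] G' j that by auto
  from ex consider "j \<in> \<Gamma>" | \<gamma> where "\<gamma> \<in> \<Gamma>" "j = \<gamma> + v 1 - v 0"
    unfolding excluded_exps_def by auto
  then show ?thesis
  proof cases
    case 2
    then have "\<gamma> \<in> \<Gamma>'" using *[of \<gamma>] v by auto
    then show ?thesis using 2 by (auto simp: excluded_exps_def)
  qed (auto simp: excluded_exps_def intro: *)
qed

section \<open>Roots and composition of power series\<close>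

lemma admissible_radical:
  fixes a :: "complex fps"
  assumes k: "k > 0" and \<epsilon>: "\<epsilon> \<noteq> 0" and a: "fps_nth a 0 = \<epsilon> ^ k"
  shows "fps_nth (fps_radical (\<lambda>_ _. \<epsilon>) k a) 0 = \<epsilon>" and "fps_radical (\<lambda>_ _. \<epsilon>) k a ^ k = a"
proof -
  obtain k' where k': "k = Suc k'" using k by (cases k) auto
  show "fps_nth (fps_radical (\<lambda>_ _. \<epsilon>) k a) 0 = \<epsilon>" using k' by simp
  show "fps_radical (\<lambda>_ _. \<epsilon>) k a ^ k = a"
    using power_radical[of a "\<lambda>_ _. \<epsilon>" k'] a \<epsilon> k' by simp
qed

text \<open>Through order \<open>m\<close> only the terms of \<open>f\<close> at \<open>b\<close>
  and \<open>m\<close> matter, and \<open>\<rho> ^ m\<close> starts with the \<open>m\<close>-th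
  power of the linear coefficient of \<open>\<rho>\<close>.\<close>

lemma fps_compose_nth_leading:
  fixes f \<rho> :: "'a::comm_ring_1 fps"
  assumes f: "fps_nth f b = 1" "\<And>j. j < m \<Longrightarrow> j \<noteq> b \<Longrightarrow> fps_nth f j = 0" and \<rho>: "fps_nth \<rho> 0 = 0"
    and bm: "b < m" and j: "j \<le> m"
  shows "fps_nth (f oo \<rho>) j =
    fps_nth (\<rho> ^ b) j + (if j = m then fps_nth f m * fps_nth \<rho> 1 ^ m else 0)"
proof -
  have low: "fps_nth (\<rho> ^ i) j = 0" if "i > j" for i
    using startsby_zero_power_prefix[OF \<rho>] that by auto
  have "fps_nth (f oo \<rho>) j = (\<Sum>i=0..j. fps_nth f i * fps_nth (\<rho> ^ i) j)"
    by (simp add: fps_compose_nth)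
  also have "\<dots> = (\<Sum>i=0..m. fps_nth f i * fps_nth (\<rho> ^ i) j)"
    using j low by (intro sum.mono_neutral_left) auto
  also have "\<dots> = (\<Sum>i\<in>{b, m}. fps_nth f i * fps_nth (\<rho> ^ i) j)"
    using f bm by (intro sum.mono_neutral_right) (auto simp: le_less)
  also have "\<dots> = fps_nth (\<rho> ^ b) j + fps_nth f m * fps_nth (\<rho> ^ m) j" using f bm by simp
  also have "fps_nth (\<rho> ^ m) j = (if j = m then fps_nth \<rho> 1 ^ m else 0)"
    using low j startsby_zero_power_nth_same[OF \<rho>] by auto
  finally show ?thesis by auto
qed

theorem theorem5p7:
  fixes n g lam :: nat and v w :: "nat \<Rightarrow> nat" and \<Gamma> :: "nat set"
    and \<phi> \<psi> :: "nat \<Rightarrow> complex fps" and \<rho> :: "complex fps" and \<sigma> :: "nat \<Rightarrow> mseries"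
  assumes "n \<ge> 1" and "g \<ge> 2"
    and "\<phi> \<in> params n w" and "w 0 = v 0"
    and "reduced_form n w \<phi>"
    and "\<Gamma> = value_set (Suc n) \<phi>" and "minimal_generators g v \<Gamma>"
    and "second_exps \<Gamma> (v 0) (v 1) \<phi> \<noteq> {}"
    and "lam = Inf (second_exps \<Gamma> (v 0) (v 1) \<phi>)"
    and "lam < v 2"
    and "admissible n w \<phi> \<rho> \<sigma>"
    and "\<psi> = germ_action n \<rho> \<sigma> \<phi>"
    and "\<psi> \<in> params n w" and "reduced_form n w \<psi>"
  shows "second_exps \<Gamma> (v 0) (v 1) \<psi> \<noteq> {} \<and> Inf (second_exps \<Gamma> (v 0) (v 1) \<psi>) = lam"
proof -
  note n = assms(1) and g = assms(2) and \<phi> = assms(3) and w0 = assms(4) and \<psi> = assms(13)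
  have mg: "minimal_generators g v (value_set (Suc n) \<phi>)" using assms(6,7) by simp
  define a b where "a = w 0" and "b = w 1"
  have w1: "w 1 = v 1" using params_v1[OF \<phi> n _ mg w0] g by simp
  have va: "v 0 = a" "v 1 = b" "v (Suc 0) = b" using w0 w1 by (auto simp: a_def b_def)
  note p = paramsD[OF \<phi> n, folded a_def b_def] and q = paramsD[OF \<psi> n, folded a_def b_def]
  note ab = p(1,2)
  have ndvd: "\<not> a dvd b" using minimal_generators_v1_not_dvd[OF mg] g va by simp
  have ex: "j \<in> excluded_exps (value_set (Suc n) \<psi>) a b"
    if "j \<in> excluded_exps \<Gamma> a b" "j < v 2" for j
    using excluded_exps_below_v2[OF mg g, of "value_set (Suc n) \<psi>" j] that va ab
      params_gen2_subset[OF \<psi> n, of "Suc n"] n assms(6) by (auto simp: a_def b_def)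
  have red\<phi>: "fps_nth (\<phi> 1) j = 0" if "b < j" "j \<in> excluded_exps \<Gamma> a b" for j
    using assms(5,6) that by (auto simp: reduced_form_def a_def b_def)
  have red\<psi>: "fps_nth (\<psi> 1) j = 0" if "b < j" "j \<in> excluded_exps \<Gamma> a b" "j < v 2" for j
    using assms(14) ex[OF that(2,3)] that(1) by (auto simp: reduced_form_def a_def b_def)

  have "lam \<in> second_exps \<Gamma> (v 0) (v 1) \<phi>" using assms(8,9) Inf_nat_def1 by simp
  then have lam: "b < lam" "lam \<notin> excluded_exps \<Gamma> a b" "fps_nth (\<phi> 1) lam \<noteq> 0"
    by (auto simp: second_exps_def va)
  have below: "fps_nth (\<phi> 1) j = 0" if "j < lam" "j \<noteq> b" for j
  proof (cases "j < b")
    case True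
    then show ?thesis using p(6)[of 1 j] n by (simp add: b_def)
  next
    case False
    have "j \<notin> second_exps \<Gamma> (v 0) (v 1) \<phi>" using that(1) assms(9) by (metis wellorder_Inf_le1 not_le)
    then show ?thesis using False that red\<phi>[of j] by (auto simp: second_exps_def va)
  qed
  have \<phi>1: "fps_nth (\<phi> 1) b = 1" and \<psi>1: "fps_nth (\<psi> 1) b = 1"
    using p(5)[of 1] q(5)[of 1] n by (auto simp: b_def)
  have \<phi>k: "fps_nth (\<phi> k) j = 0" if "k \<in> {2..n}" "j \<le> lam" for k j
    using params_v2_le[OF \<phi> n g mg w0 that(1)] p(6)[of k j] that assms(10) by auto

  \<comment> \<open>Expansion of the admissible pair along the curve\<close>
  obtain \<epsilon> h where \<epsilon>: "\<epsilon> \<noteq> 0"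
    and \<rho>: "\<rho> = fps_X * fps_radical (\<lambda>_ _. \<epsilon>) (w 0)
              (fps_const (\<epsilon> ^ w 0) + fps_shift (w 0) (ms_subst (Suc n) (h 0) \<phi>))"
    and \<sigma>: "\<And>k. k \<le> n \<Longrightarrow> \<sigma> k = (\<lambda>\<alpha>. \<epsilon> ^ w k * ms_var k \<alpha> + h k \<alpha>)"
    and h: "\<And>k. k \<le> n \<Longrightarrow> ms_subst (Suc n) (h k) \<phi> = 0 \<or> w k < subdegree (ms_subst (Suc n) (h k) \<phi>)"
    using assms(11) unfolding admissible_def by blast
  define H where "H k = ms_subst (Suc n) (h k) \<phi>" for k
  have Hlow: "fps_nth (H k) j = 0" if "k \<le> n" "j \<le> w k" for k j
    using h[OF that(1)] that(2) by (auto simp: H_def intro: nth_less_subdegree_zero)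
  \<comment> \<open>\<open>h_1\<close> evaluated on the curve has order above \<open>b\<close>, so
    its coefficient at \<open>b\<close>, which is the \<open>Y_1\<close> coefficient of
    \<open>h_1\<close>, vanishes.\<close>
  have h1: "h 1 (Poly_Mapping.single 1 1) = 0"
    using ms_subst_nth_order_second[OF n ab lam(1) ndvd p(3) \<phi>1 below \<phi>k, of "h 1"] Hlow[of 1 b] n
    by (simp add: H_def b_def)
  \<comment> \<open>Order \<open>lam\<close> is claimed for \<open>k = 1\<close> only:
    \<open>h_0\<close> may contain \<open>Y_1\<close> linearly, and \<open>Y_1\<close> has the term
    of order \<open>lam\<close>.\<close>
  have H: "j \<in> gen2 a b" if "fps_nth (H k) j \<noteq> 0" "j < lam \<or> j = lam \<and> k = 1" for j k
    using ms_subst_support[OF n ab lam(1) p(3) \<phi>1 below \<phi>k, of j "h k"] that h1 by (auto simp: H_def)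

  define R where "R = fps_radical (\<lambda>_ _. \<epsilon>) a (fps_const (\<epsilon> ^ a) + fps_shift a (H 0))"
  have \<rho>R: "\<rho> = fps_X * R" by (simp add: \<rho> R_def H_def a_def)
  have R0: "fps_nth R 0 = \<epsilon>" and Ra: "R ^ a = fps_const (\<epsilon> ^ a) + fps_shift a (H 0)"
    using admissible_radical[OF ab(1) \<epsilon>, of "fps_const (\<epsilon> ^ a) + fps_shift a (H 0)"] Hlow[of 0 a]
    by (auto simp: R_def a_def)
  have \<rho>0: "fps_nth \<rho> 0 = 0" "fps_nth \<rho> 1 = \<epsilon>" using R0 by (auto simp: \<rho>R)
  have \<rho>b: "fps_nth (\<rho> ^ b) j = (if j < b then 0 else fps_nth (R ^ b) (j - b))" for j
    by (simp add: \<rho>R power_mult_distrib fps_X_power_mult_nth)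
  have var: "ms_subst (Suc n) (ms_var 1) \<phi> = \<phi> 1"
    using ms_subst_monom[of "Poly_Mapping.single 1 1" "Suc n" \<phi>] n p(4)
      prod_lessThan_Suc_split2[OF n, of "\<lambda>i. \<phi> i ^ Poly_Mapping.lookup (Poly_Mapping.single 1 1) i"]
    by (simp add: ms_var_eq lookup_single when_def)
  \<comment> \<open>Composing with \<open>\<rho>\<close> removes the inverse in
    \<open>\<psi>\<close>, giving an identity that expresses \<open>\<rho> ^ b\<close> through known
    series.\<close>
  have "\<psi> 1 oo \<rho> = ms_subst (Suc n) (\<sigma> 1) \<phi> oo (fps_inv \<rho> oo \<rho>)"
    using \<rho>0 by (simp add: assms(12) germ_action_def fps_compose_assoc fps_inv_def)
  also have "\<dots> = ms_subst (Suc n) (\<sigma> 1) \<phi>" using fps_inv[of \<rho>] \<rho>0 \<epsilon> by simp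
  also have "\<dots> = fps_const (\<epsilon> ^ b) * \<phi> 1 + H 1"
    using \<sigma>[of 1] n var ms_subst_linear[of "Suc n" "\<epsilon> ^ b" "ms_var 1" "h 1" \<phi>]
    by (simp add: H_def b_def)
  finally have eq: "\<psi> 1 oo \<rho> = fps_const (\<epsilon> ^ b) * \<phi> 1 + H 1" .

  \<comment> \<open>\<open>lam\<close> witnesses existence through \<open>\<phi>\<close>. Admitting
    terms of either series treats both symmetrically while nothing is known yet about the exponents
    of \<open>\<psi>\<close>.\<close>
  define \<mu> where "\<mu> = (LEAST j. b < j \<and> (fps_nth (\<phi> 1) j \<noteq> 0 \<or> fps_nth (\<psi> 1) j \<noteq> 0))"
  have \<mu>: "b < \<mu>" "fps_nth (\<phi> 1) \<mu> \<noteq> 0 \<or> fps_nth (\<psi> 1) \<mu> \<noteq> 0"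
    using LeastI[of "\<lambda>j. b < j \<and> (fps_nth (\<phi> 1) j \<noteq> 0 \<or> fps_nth (\<psi> 1) j \<noteq> 0)" lam] lam
    unfolding \<mu>_def by blast+
  have \<mu>lam: "\<mu> \<le> lam" unfolding \<mu>_def using lam by (intro Least_le) auto
  have \<mu>min: "fps_nth (\<phi> 1) j = 0" "fps_nth (\<psi> 1) j = 0" if "b < j" "j < \<mu>" for j
    using not_less_Least[OF that(2)[unfolded \<mu>_def]] that(1) by auto
  have \<psi>low: "fps_nth (\<psi> 1) j = 0" if "j < \<mu>" "j \<noteq> b" for j
    using \<mu>min(2)[of j] q(6)[of 1 j] that n by (cases "j < b") (auto simp: b_def)
  \<comment> \<open>Whichever series has a term at \<open>\<mu>\<close> is reduced; for
    \<open>\<psi>\<close> this uses \<open>\<mu> \<le> lam < v 2\<close>.\<close>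
  have \<mu>ex: "\<mu> \<notin> excluded_exps \<Gamma> a b"
    using \<mu> red\<phi>[of \<mu>] red\<psi>[of \<mu>] \<mu>lam assms(10) by auto
  have S\<Gamma>: "gen2 a b \<subseteq> \<Gamma>"
    using params_gen2_subset[OF \<phi> n, of "Suc n"] n assms(6) by (simp add: a_def b_def)
  have \<mu>S: "\<mu> \<notin> gen2 a b" using \<mu>ex S\<Gamma> by (auto simp: excluded_exps_def)
  have \<mu>S': "\<mu> - b + a \<notin> gen2 a b"
  proof
    assume "\<mu> - b + a \<in> gen2 a b"
    moreover have "\<mu> = (\<mu> - b + a) + b - a" using \<mu>(1) by simp
    ultimately show False using \<mu>ex S\<Gamma> unfolding excluded_exps_def by blast
  qed
  have coeff: "fps_nth (R ^ b) (j - b) + (if j = \<mu> then fps_nth (\<psi> 1) \<mu> * \<epsilon> ^ \<mu> else 0)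
      = \<epsilon> ^ b * fps_nth (\<phi> 1) j + fps_nth (H 1) j" if "b \<le> j" "j \<le> \<mu>" for j
    using fps_compose_nth_leading[OF \<psi>1 \<psi>low \<rho>0(1) \<mu>(1) that(2)] that(1) \<rho>0(2) eq
    by (simp add: \<rho>b)
  have "fps_nth (R ^ b) (\<mu> - b) = 0"
  proof (rule gap_coefficient_vanishes[OF ab \<mu>(1) _ \<mu>S \<mu>S'])
    show "fps_nth R 0 \<noteq> 0" using R0 \<epsilon> by simp
  next
    fix j assume j: "j \<le> \<mu> - b" "fps_nth (R ^ a) j \<noteq> 0"
    show "j + a \<in> gen2 a b"
    proof (cases "j = 0")
      case True
      then show ?thesis using gen2I[of 1 a 0 b] by simp
    next
      case False
      \<comment> \<open>The order \<open>j + a\<close> is at most \<open>\<mu> - b + a\<close>,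
        which is strictly below \<open>\<mu>\<close> as \<open>a < b\<close>, so the restricted
        range of \<open>H\<close> for \<open>k = 0\<close> is enough.\<close>
      then show ?thesis using j Ra H[of 0 "j + a"] ab \<mu>(1) \<mu>lam by simp
    qed
  next
    fix j assume j: "j < \<mu> - b" "fps_nth (R ^ b) j \<noteq> 0"
    show "j + b \<in> gen2 a b"
    proof (cases "j = 0")
      case True
      then show ?thesis using gen2I[of 0 a 1 b] by simp
    next
      case False
      have "j + b < \<mu>" using j by simp
      \<comment> \<open>Strictly between \<open>b\<close> and \<open>\<mu>\<close> the series
        \<open>\<phi> 1\<close> has no terms, so the coefficient of \<open>R ^ b\<close> equals one
        of \<open>H 1\<close>.\<close>
      then have "fps_nth (H 1) (j + b) \<noteq> 0"
        using j False coeff[of "j + b"] \<mu>min(1)[of "j + b"] by simp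
      then show ?thesis using H[of 1 "j + b"] \<open>j + b < \<mu>\<close> \<mu>lam by simp
    qed
  qed
  moreover have "fps_nth (H 1) \<mu> = 0" using H[of 1 \<mu>] \<mu>S \<mu>lam le_neq_implies_less by blast
  ultimately have "fps_nth (\<psi> 1) \<mu> * \<epsilon> ^ \<mu> = \<epsilon> ^ b * fps_nth (\<phi> 1) \<mu>"
    using coeff[of \<mu>] \<mu>(1) by simp
  then have nz: "fps_nth (\<phi> 1) \<mu> \<noteq> 0" "fps_nth (\<psi> 1) \<mu> \<noteq> 0" using \<mu>(2) \<epsilon> by auto
  \<comment> \<open>\<open>\<phi> 1\<close> has a term at \<open>\<mu>\<close>, but none strictly
    between \<open>b\<close> and \<open>lam\<close>.\<close>
  have "\<mu> = lam" using below[of \<mu>] nz \<mu>(1) \<mu>lam by force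
  then have mem: "lam \<in> second_exps \<Gamma> (v 0) (v 1) \<psi>"
    using nz lam by (auto simp: second_exps_def va)
  moreover have "lam \<le> j" if "j \<in> second_exps \<Gamma> (v 0) (v 1) \<psi>" for j
    using that \<mu>min(2)[of j] \<open>\<mu> = lam\<close> by (force simp: second_exps_def va)
  ultimately show ?thesis by (metis cInf_eq_minimum empty_iff)
qed

end
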